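(* Let $N\ge1$, $m\ge2$, let $H\in C^2(\mathbb{R}^m,\mathbb{R})$, and let $u=(u_1,\dots,u_m):\mathbb{R}^N\to\mathbb{R}^m$ be a bounded monotone (classical, $C^2$) solution of $\Delta u=\nabla H(u)$ on $\mathbb{R}^N$ such that all its components $u_i$ have common level sets. Let $V_i:\mathrm{Range}(u_i)\to\mathbb{R}$, $i=1,\dots,m$, be decoupling potentials for $u$ and set $\bar V_i=\inf_{p_i\in\mathrm{Range}(u_i)}V_i(p_i)$. Then for all $x\in\mathbb{R}^N$, $$\frac12\sum_{i=1}^m|\nabla u_i(x)|^2\le H(u(x))-\sum_{i=1}^m\bar V_i.$$
   Context: Points of $\mathbb{R}^N$ are written $x=(x',x_N)\in\mathbb{R}^{N-1}\times\mathbb{R}$. The system $\Delta u=\nabla H(u)$ means $\Delta u_i=\frac{\partial H}{\partial p_i}(u_1,\dots,u_m)$ for $i=1,\dots,m$. Monotone: for every $i$, $\frac{\partial u_i}{\partial x_N}(x)\ne0$ for all $x\in\mathbb{R}^N$. Common level sets: for any $i\ne j$ and any $\lambda\in\mathbb{R}$ there exists $\bar\lambda\in\mathbb{R}$ such that $\{x:u_i(x)=\lambda\}=\{x:u_j(x)=\bar\lambda\}$. Decoupling potentials: differentiable functions $V_i:\mathrm{Range}(u_i)\to\mathbb{R}$ ($i=1,\dots,m$) such that $\Delta u_i(x)=V_i'(u_i(x))$ for all $x\in\mathbb{R}^N$ and all $i$, and $\sum_{i=1}^mV_i(u_i(x))=H(u(x))$ for all $x\in\mathbb{R}^N$. (For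 $u$ monotone with common level sets such functions exist and are unique up to adding constants $c_i$ with $\sum_ic_i=0$.) *)

theory Defs
  imports "HOL-Analysis.Analysis"
begin

text \<open>The value of \<open>partial\<close> is meaningful only where \<open>f\<close> is differentiable; \<open>C2\<close> below
  guarantees this for the functions it is applied to.\<close>

definition partial :: "'n::finite \<Rightarrow> (real^'n \<Rightarrow> real) \<Rightarrow> real^'n \<Rightarrow> real" where
  "partial i f x = frechet_derivative f (at x) (axis i 1)"

definition C1 :: "(real^'n::finite \<Rightarrow> real) \<Rightarrow> bool" where
  "C1 f \<longleftrightarrow> (\<forall>x. f differentiable (at x)) \<and> (\<forall>i. continuous_on UNIV (partial i f))"

definition C2 :: "(real^'n::finite \<Rightarrow> real) \<Rightarrow> bool" where
  "C2 f \<longleftrightarrow> C1 f \<and> (\<forall>i. C1 (partial i f))"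

definition gradient :: "(real^'n::finite \<Rightarrow> real) \<Rightarrow> real^'n \<Rightarrow> real^'n" where
  "gradient f x = (\<chi> i. partial i f x)"

definition laplacian :: "(real^'n::finite \<Rightarrow> real) \<Rightarrow> real^'n \<Rightarrow> real" where
  "laplacian f x = (\<Sum>i\<in>UNIV. partial i (partial i f) x)"

definition component :: "(real^'n::finite \<Rightarrow> real^'m::finite) \<Rightarrow> 'm \<Rightarrow> real^'n \<Rightarrow> real" where
  "component u i = (\<lambda>x. u x $ i)"

definition classical_solution ::
    "(real^'m \<Rightarrow> real) \<Rightarrow> (real^'n::finite \<Rightarrow> real^'m::finite) \<Rightarrow> bool" where
  "classical_solution H u \<longleftrightarrow>
     (\<forall>i. C2 (component u i)) \<and> (\<forall>x i. laplacian (component u i) x = partial i H (u x))"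

text \<open>The index \<open>k\<close> designates the coordinate written \<open>x\<^sub>N\<close> in \<open>x = (x', x\<^sub>N)\<close>; a finite
  index type has no intrinsic last element.\<close>

definition monotone_in :: "'n \<Rightarrow> (real^'n::finite \<Rightarrow> real^'m::finite) \<Rightarrow> bool" where
  "monotone_in k u \<longleftrightarrow> (\<forall>i x. partial k (component u i) x \<noteq> 0)"

definition common_level_sets :: "(real^'n::finite \<Rightarrow> real^'m::finite) \<Rightarrow> bool" where
  "common_level_sets u \<longleftrightarrow>
     (\<forall>i j. i \<noteq> j \<longrightarrow> (\<forall>l. \<exists>l'. {x. component u i x = l} = {x. component u j x = l'}))"

text \<open>Each \<open>V i\<close> is a total function, but only its restriction to \<open>range (component u i)\<close> is
  constrained: the derivative is taken within that range.\<close>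

definition decoupling_potentials ::
    "(real^'m \<Rightarrow> real) \<Rightarrow> (real^'n::finite \<Rightarrow> real^'m::finite) \<Rightarrow> ('m \<Rightarrow> real \<Rightarrow> real) \<Rightarrow> bool"
  where
  "decoupling_potentials H u V \<longleftrightarrow>
     (\<forall>i x. (V i has_real_derivative laplacian (component u i) x)
               (at (component u i x) within range (component u i))) \<and>
     (\<forall>x. (\<Sum>i\<in>UNIV. V i (component u i x)) = H (u x))"

end

theory Submission
  imports Defs
begin

text \<open>
  Each component solves a scalar equation \<open>\<Delta>u = V'(u)\<close>, so it suffices to prove Modica's bound
  \<open>|\<nabla>u|\<^sup>2/2 \<le> V(u) - inf V\<close> and to sum it over the components.

  Since \<open>V\<close> is merely differentiable, the usual P-function argument, which needs third derivatives
  and compactness of translates, is replaced by a two-point maximum principle. With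
  \<open>F = V - inf V\<close>, put \<open>G(s) = F(s) + c - \<delta> exp(\<mu>s)\<close> and \<open>w = \<psi>(u)\<close> where \<open>\<psi>' = 1/sqrt(2G)\<close>; then
  \<open>\<Delta>w = K + \<beta> (1 - |\<nabla>w|\<^sup>2)\<close> with \<open>K = (F' - G')/sqrt(2G)\<close>, a strictly increasing function of \<open>u\<close> once
  \<open>\<mu>\<close> is large. If \<open>w(x) - w(y) > |x - y|\<close> somewhere, maximise
  \<open>w(x) - w(y) - |x - y| - \<epsilon>|x|\<^sup>2\<close>: at the maximum both gradients are nearly unit vectors, and
  moving \<open>x\<close> and \<open>y\<close> in parallel leaves \<open>|x - y|\<close> fixed, so \<open>\<Delta>w(x) - \<Delta>w(y) \<le> O(\<epsilon>)\<close>, contradicting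
  \<open>K(u(x)) > K(u(y))\<close>. Hence \<open>w\<close> is 1-Lipschitz, that is \<open>|\<nabla>u|\<^sup>2 \<le> 2G(u) \<le> 2(F(u) + c)\<close>; let \<open>c \<rightarrow> 0\<close>.
\<close>

section \<open>One-variable calculus and directional derivatives\<close>

text \<open>If \<open>d > 0\<close>, then \<open>p\<close> is positive just to the right of its zero
  at 0, and the mean value theorem lifts \<open>\<phi>\<close> above its maximum. The second
  derivative is thus required at the single point 0 only.\<close>

lemma second_derivative_nonpos_at_max:
  fixes \<phi> :: "real \<Rightarrow> real"
  assumes max: "\<And>t. \<phi> t \<le> \<phi> 0"
    and d1: "\<And>t. (\<phi> has_real_derivative p t) (at t)"
    and d2: "(p has_real_derivative d) (at 0)"
  shows "d \<le> 0"
proof (rule ccontr)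
  assume "\<not> d \<le> 0"
  then have "d > 0" by simp
  have p0: "p 0 = 0"
    using DERIV_local_max[OF d1[of 0], of 1] max by auto
  obtain e where e: "e > 0" "\<And>h. 0 < h \<Longrightarrow> h < e \<Longrightarrow> p 0 < p (0 + h)"
    using DERIV_pos_inc_right[OF d2 \<open>d > 0\<close>] by auto
  have "\<exists>z. 0 < z \<and> z < e/2 \<and> \<phi> (e/2) - \<phi> 0 = (e/2 - 0) * p z"
    by (rule MVT2) (use e d1 in auto)
  then obtain z where z: "0 < z" "z < e/2" "\<phi> (e/2) - \<phi> 0 = (e/2) * p z" by auto
  have "p z > 0" using e(2)[of z] z p0 e(1) by auto
  then have "\<phi> (e/2) - \<phi> 0 > 0" unfolding z(3) using e(1) by (intro mult_pos_pos) auto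
  then show False using max[of "e/2"] by simp
qed

text \<open>Mean value inequality with derivatives taken within \<open>S\<close>, since potentials
  are differentiable only within the range of a component.\<close>

lemma increment_ge_of_derivative_ge:
  fixes f :: "real \<Rightarrow> real"
  assumes "r \<le> s" and sub: "{r..s} \<subseteq> S"
    and d: "\<And>z. z \<in> S \<Longrightarrow> (f has_real_derivative f' z) (at z within S)"
    and m: "\<And>z. z \<in> S \<Longrightarrow> m \<le> f' z"
  shows "m * (s - r) \<le> f s - f r"
proof (cases "r = s")
  case False
  with \<open>r \<le> s\<close> have "r < s" by simp
  have "\<exists>z\<in>{r<..<s}. f s - f r = (\<lambda>h. f' z * h) (s - r)"
  proof (rule mvt_simple[OF \<open>r < s\<close>])
    fix z assume "r \<le> z" "z \<le> s"
    then have "z \<in> S" using sub by auto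
    from has_field_derivative_subset[OF d[OF this] sub]
    show "(f has_derivative (\<lambda>h. f' z * h)) (at z within {r..s})"
      by (simp add: has_field_derivative_def)
  qed
  then obtain z where z: "z \<in> {r<..<s}" "f s - f r = f' z * (s - r)" by auto
  have "z \<in> S" using z sub by auto
  with m[of z] \<open>r < s\<close> z show ?thesis by (simp add: mult_right_mono)
qed simp

lemma has_derivative_line:
  fixes x :: "'a::real_normed_vector"
  assumes "(f has_derivative f') (at (x + t *\<^sub>R v))"
  shows "((\<lambda>t. f (x + t *\<^sub>R v)) has_real_derivative f' v) (at t)"
proof -
  interpret bounded_linear f' using assms by (rule has_derivative_bounded_linear)
  have "((\<lambda>t. x + t *\<^sub>R v) has_derivative (\<lambda>h. h *\<^sub>R v)) (at t)"
    by (auto intro!: derivative_eq_intros)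
  from diff_chain_at[OF this assms]
  show ?thesis unfolding has_field_derivative_def o_def
    by (simp add: scaleR mult.commute[of _ "f' v"])
qed

text \<open>Moving from \<open>x\<close> along \<open>g\<close>, \<open>w\<close> grows at rate
  \<open>g \<bullet> g\<close>, while the Lipschitz bound allows only \<open>norm g\<close>.\<close>

lemma gradient_norm_le_one:
  fixes w :: "'a::real_inner \<Rightarrow> real"
  assumes d: "(w has_derivative (\<lambda>v. g \<bullet> v)) (at x)"
    and lip: "\<And>y. w y - w x \<le> norm (y - x)"
  shows "norm g \<le> 1"
proof (rule ccontr)
  assume n: "\<not> norm g \<le> 1"
  have "((\<lambda>t. w (x + t *\<^sub>R g)) has_real_derivative g \<bullet> g) (at 0)"
    by (rule has_derivative_line) (use d in simp)
  then have d: "((\<lambda>t. w (x + t *\<^sub>R g) - t * norm g) has_real_derivative g \<bullet> g - norm g) (at 0)"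
    by (auto intro!: derivative_eq_intros)
  have "norm g * 1 < norm g * norm g" using n by (intro mult_strict_left_mono) auto
  then have "g \<bullet> g - norm g > 0" by (simp add: dot_square_norm power2_eq_square)
  from DERIV_pos_inc_right[OF d this] obtain e where e: "e > 0"
      "\<And>h. 0 < h \<Longrightarrow> h < e \<Longrightarrow> w x < w (x + h *\<^sub>R g) - h * norm g"
    by auto
  have "w x < w (x + (e/2) *\<^sub>R g) - (e/2) * norm g" using e(2)[of "e/2"] e(1) by simp
  moreover have "w (x + (e/2) *\<^sub>R g) - w x \<le> (e/2) * norm g"
    using lip[of "x + (e/2) *\<^sub>R g"] e by simp
  ultimately show False by simp
qed

section \<open>The two-point maximum principle\<close>

text \<open>Where the objective is positive, boundedness of \<open>w\<close> bounds both
  \<open>norm (x - y)\<close> and \<open>\<epsilon> * (norm x)^2\<close>. Penalising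
  \<open>x\<close> alone therefore confines both points to a compact set.\<close>

lemma penalised_max:
  fixes w :: "'a::euclidean_space \<Rightarrow> real"
  assumes cont: "continuous_on UNIV w" and W: "\<And>x. \<bar>w x\<bar> \<le> W"
    and "\<epsilon> > 0" and pos: "w a - w b - norm (a - b) - \<epsilon> * (norm a)\<^sup>2 > 0"
  obtains x y where
    "\<And>x' y'. w x' - w y' - norm (x' - y') - \<epsilon> * (norm x')\<^sup>2
        \<le> w x - w y - norm (x - y) - \<epsilon> * (norm x)\<^sup>2"
proof -
  define Z where "Z = (\<lambda>p. w (fst p) - w (snd p) - norm (fst p - snd p) - \<epsilon> * (norm (fst p))\<^sup>2)"
  define R where "R = sqrt (2 * W / \<epsilon>)"
  define C where "C = cball (0::'a) R \<times> cball (0::'a) (R + 2 * W)"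
  have inC: "p \<in> C" if "Z p > 0" for p
  proof -
    obtain x y where p: "p = (x, y)" by (cases p)
    have le: "norm (x - y) + \<epsilon> * (norm x)\<^sup>2 < 2 * W"
      using that W[of x] W[of y] by (simp add: Z_def p)
    have "\<epsilon> * (norm x)\<^sup>2 < 2 * W" using le norm_ge_zero[of "x - y"] by linarith
    then have "(norm x)\<^sup>2 \<le> 2 * W / \<epsilon>" using \<open>\<epsilon> > 0\<close> by (simp add: field_simps)
    then have nx: "norm x \<le> R" unfolding R_def by (rule real_le_rsqrt)
    have "0 \<le> \<epsilon> * (norm x)\<^sup>2" using \<open>\<epsilon> > 0\<close> by simp
    then have "norm (x - y) \<le> 2 * W" using le by linarith
    then have "norm y \<le> R + 2 * W"
      using nx norm_triangle_ineq4[of x "x - y"] by simp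
    with nx show ?thesis by (simp add: C_def p)
  qed
  have ab: "Z (a, b) > 0" using pos by (simp add: Z_def)
  have comp: "compact C" unfolding C_def by (intro compact_Times compact_cball)
  have ne: "C \<noteq> {}" using inC[OF ab] by auto
  have "continuous_on C Z"
    unfolding Z_def
    by (intro continuous_intros continuous_on_compose2[OF cont]) auto
  from continuous_attains_sup[OF comp ne this]
  obtain p where p: "p \<in> C" "\<And>q. q \<in> C \<Longrightarrow> Z q \<le> Z p" by auto
  \<comment> \<open>The maximum over \<open>C\<close> is global: it is at least
    \<open>Z (a, b) > 0\<close>, and \<open>Z\<close> is not positive outside
    \<open>C\<close>.\<close>
  have "Z q \<le> Z p" for q
    using p(2)[of q] p(2)[OF inC[OF ab]] ab inC[of q] by linarith
  note Zp = this
  show ?thesis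
  proof (rule that[of "fst p" "snd p"])
    show "w x' - w y' - norm (x' - y') - \<epsilon> * (norm x')\<^sup>2
        \<le> w (fst p) - w (snd p) - norm (fst p - snd p) - \<epsilon> * (norm (fst p))\<^sup>2" for x' y'
      using Zp[of "(x', y')"] by (simp add: Z_def)
  qed
qed

lemma local_max_gradient:
  fixes g :: "'a::real_inner"
  assumes d: "(f has_derivative (\<lambda>v. g \<bullet> v)) (at x)" and max: "\<And>y. f y \<le> f x"
  shows "g = 0"
proof -
  have "(\<lambda>v. g \<bullet> v) = (\<lambda>v. 0)"
    by (rule differential_zero_maxmin[OF _ open_UNIV d]) (use max in auto)
  then have "g \<bullet> g = 0" by metis
  then show ?thesis by simp
qed

lemma has_derivative_norm_diff:
  fixes x y :: "'a::real_inner"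
  assumes "x \<noteq> y"
  shows "((\<lambda>z. norm (z - y)) has_derivative (\<lambda>v. sgn (x - y) \<bullet> v)) (at x)"
proof -
  have "((\<lambda>z. z - y) has_derivative (\<lambda>v. v)) (at x)" by (auto intro!: derivative_eq_intros)
  from diff_chain_at[OF this has_derivative_norm] assms show ?thesis
    by (simp add: o_def inner_commute)
qed

text \<open>The hypothesis on \<open>K\<close> is strict monotonicity along \<open>w\<close> with a
  gap \<open>\<kappa>\<close> uniform in the points. Uniformity is what survives the removal of the
  penalty, during which the maximum points may escape to infinity.\<close>

lemma two_point_Lipschitz:
  fixes w :: "real^'n::finite \<Rightarrow> real"
  assumes W: "\<And>x. \<bar>w x\<bar> \<le> W"
    and grad: "\<And>x. (w has_derivative (\<lambda>v. g x \<bullet> v)) (at x)"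
    and hess: "\<And>x i. ((\<lambda>t. g (x + t *\<^sub>R axis i 1) $ i) has_real_derivative D x i) (at 0)"
    and lap: "\<And>x. (\<Sum>i\<in>UNIV. D x i) = K x + \<beta> x * (1 - (norm (g x))\<^sup>2)"
    and b: "\<And>x. \<bar>\<beta> x\<bar> \<le> b"
    and K: "\<And>M. M > 0 \<Longrightarrow> \<exists>\<kappa>>0. \<forall>x y. w x - w y \<ge> M \<longrightarrow> K x - K y \<ge> \<kappa>"
  shows "w x - w y \<le> norm (x - y)"
proof (rule ccontr)
  assume "\<not> w x - w y \<le> norm (x - y)"
  \<comment> \<open>The excess is called \<open>2 * M\<close> so that one half can be spent on the
    penalty at \<open>x\<close> and the other half remains at the maximum.\<close>
  then obtain M where M: "M > 0" "w x - w y - norm (x - y) = 2 * M"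
    using that[of "(w x - w y - norm (x - y)) / 2"] by simp
  obtain \<kappa> where \<kappa>: "\<kappa> > 0" "\<And>x y. w x - w y \<ge> M \<Longrightarrow> K x - K y \<ge> \<kappa>"
    using K[OF \<open>M > 0\<close>] by auto
  have W0: "W \<ge> 0" using W[of 0] by linarith
  have b0: "b \<ge> 0" using b[of 0] by linarith
  \<comment> \<open>\<open>C\<close> will bound \<open>\<delta> * norm p\<close>, so the gradient of
    the penalty at \<open>p\<close> has norm at most \<open>2 * \<delta> * C\<close>.\<close>
  define C where "C = sqrt (2 * W)"
  have cont: "continuous_on UNIV w"
    using grad by (meson continuous_at_imp_continuous_on has_derivative_continuous)
  \<comment> \<open>Here \<open>\<delta>^2\<close> is the penalty weight. Its square root is the
    natural scale of the errors: the right-hand side tends to 0 with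
    \<open>\<delta>\<close>.\<close>
  have bound: "\<kappa> \<le> 2 * \<delta>\<^sup>2 * CARD('n) + b * (4 * \<delta> * C + 4 * \<delta>\<^sup>2 * C\<^sup>2)"
    if \<delta>: "\<delta> > 0" "\<delta>\<^sup>2 * (norm x)\<^sup>2 \<le> M" for \<delta> :: real
  proof -
    have "w x - w y - norm (x - y) - \<delta>\<^sup>2 * (norm x)\<^sup>2 > 0" using M \<delta> by simp
    from penalised_max[OF cont W _ this] \<delta>(1)
    obtain p q where pq: "\<And>x' y'. w x' - w y' - norm (x' - y') - \<delta>\<^sup>2 * (norm x')\<^sup>2
        \<le> w p - w q - norm (p - q) - \<delta>\<^sup>2 * (norm p)\<^sup>2"
      by (auto simp: zero_less_power)
    have ge: "w p - w q - norm (p - q) - \<delta>\<^sup>2 * (norm p)\<^sup>2 \<ge> M"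
      using pq[of x y] M \<delta> by linarith
    have sq: "0 \<le> \<delta>\<^sup>2 * (norm p)\<^sup>2" by simp
    have wpq: "w p - w q \<ge> M" using ge sq norm_ge_zero[of "p - q"] by linarith
    then have "p \<noteq> q" using M by auto
    have "(\<delta> * norm p)\<^sup>2 \<le> 2 * W"
      using ge sq norm_ge_zero[of "p - q"] W[of p] W[of q] M unfolding power_mult_distrib by linarith
    then have dp: "\<delta> * norm p \<le> C" unfolding C_def by (rule real_le_rsqrt)
    have "((\<lambda>z. w z - w q - norm (z - q) - \<delta>\<^sup>2 * (norm z)\<^sup>2) has_derivative
        (\<lambda>v. (g p - sgn (p - q) - (2 * \<delta>\<^sup>2) *\<^sub>R p) \<bullet> v)) (at p)"
      unfolding power2_norm_eq_inner
      by (auto intro!: derivative_eq_intros grad has_derivative_norm_diff \<open>p \<noteq> q\<close>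
          simp: inner_diff_left inner_commute algebra_simps fun_eq_iff)
    then have "g p - sgn (p - q) - (2 * \<delta>\<^sup>2) *\<^sub>R p = 0"
      by (rule local_max_gradient) (rule pq)
    then have gp: "g p = sgn (p - q) + (2 * \<delta>\<^sup>2) *\<^sub>R p" by (simp add: algebra_simps)
    \<comment> \<open>The second point carries no penalty, so its gradient is exactly a unit vector
      and the \<open>\<beta>\<close> term vanishes at \<open>q\<close>.\<close>
    have "((\<lambda>z. w p - w z - norm (z - p) - \<delta>\<^sup>2 * (norm p)\<^sup>2) has_derivative
        (\<lambda>v. (- g q - sgn (q - p)) \<bullet> v)) (at q)"
      by (auto intro!: derivative_eq_intros grad has_derivative_norm_diff \<open>p \<noteq> q\<close>[symmetric]
          simp: inner_diff_left)
    then have "- g q - sgn (q - p) = 0"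
    proof (rule local_max_gradient)
      show "w p - w y - norm (y - p) - \<delta>\<^sup>2 * (norm p)\<^sup>2
          \<le> w p - w q - norm (q - p) - \<delta>\<^sup>2 * (norm p)\<^sup>2" for y
        using pq[of p y] unfolding norm_minus_commute[of y p] norm_minus_commute[of q p] .
    qed
    then have "g q = - sgn (q - p)" by (metis add.inverse_inverse eq_iff_diff_eq_0)
    then have gq: "norm (g q) = 1" using \<open>p \<noteq> q\<close> by (simp add: norm_sgn)
    have "norm (g p) \<le> 1 + 2 * \<delta> * C"
    proof -
      have "norm (g p) \<le> 1 + 2 * \<delta> * (\<delta> * norm p)"
        unfolding gp using norm_triangle_ineq[of "sgn (p - q)" "(2 * \<delta>\<^sup>2) *\<^sub>R p"] \<open>p \<noteq> q\<close>
        by (simp add: norm_sgn power2_eq_square)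
      also have "\<dots> \<le> 1 + 2 * \<delta> * C" using dp \<delta> by (intro add_left_mono mult_left_mono) auto
      finally show ?thesis .
    qed
    moreover have "norm (g p) \<ge> 1 - 2 * \<delta> * C"
    proof -
      have "norm (g p) \<ge> 1 - 2 * \<delta> * (\<delta> * norm p)"
        unfolding gp using norm_diff_ineq[of "sgn (p - q)" "(2 * \<delta>\<^sup>2) *\<^sub>R p"] \<open>p \<noteq> q\<close>
        by (simp add: norm_sgn power2_eq_square)
      moreover have "2 * \<delta> * (\<delta> * norm p) \<le> 2 * \<delta> * C" using dp \<delta> by (intro mult_left_mono) auto
      ultimately show ?thesis by linarith
    qed
    ultimately have ab: "\<bar>1 - norm (g p)\<bar> \<le> 2 * \<delta> * C" by linarith
    have "\<bar>1 - (norm (g p))\<^sup>2\<bar> = \<bar>1 - norm (g p)\<bar> * (1 + norm (g p))"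
    proof -
      have "1 - (norm (g p))\<^sup>2 = (1 - norm (g p)) * (1 + norm (g p))"
        by (simp add: power2_eq_square algebra_simps)
      then show ?thesis by (simp add: abs_mult)
    qed
    also have "\<dots> \<le> (2 * \<delta> * C) * (2 + 2 * \<delta> * C)"
      by (rule mult_mono) (use ab abs_ge_zero[of "1 - norm (g p)"] norm_ge_zero[of "g p"] in linarith)+
    also have "\<dots> = 4 * \<delta> * C + 4 * \<delta>\<^sup>2 * C\<^sup>2" by (simp add: power2_eq_square algebra_simps)
    finally have g1: "\<bar>1 - (norm (g p))\<^sup>2\<bar> \<le> 4 * \<delta> * C + 4 * \<delta>\<^sup>2 * C\<^sup>2" .
    have Di: "D p i - D q i - 2 * \<delta>\<^sup>2 \<le> 0" for i
    proof (rule second_derivative_nonpos_at_max)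
      define e :: "real^'n" where "e = axis i 1"
      have ge: "z \<bullet> e = z $ i" for z by (simp add: e_def inner_axis)
      let ?\<phi> = "\<lambda>t. w (p + t *\<^sub>R e) - w (q + t *\<^sub>R e) - \<delta>\<^sup>2 * (norm (p + t *\<^sub>R e))\<^sup>2"
      let ?p = "\<lambda>t. g (p + t *\<^sub>R axis i 1) $ i - g (q + t *\<^sub>R axis i 1) $ i - 2 * \<delta>\<^sup>2 * (p $ i + t)"
      show "?\<phi> t \<le> ?\<phi> 0" for t
        using pq[of "p + t *\<^sub>R e" "q + t *\<^sub>R e"] by simp
      have "e \<bullet> e = 1" by (simp add: e_def inner_axis_axis)
      then have nrm: "(norm (p + t *\<^sub>R e))\<^sup>2 = p \<bullet> p + 2 * t * (p $ i) + t * t" for t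
        unfolding power2_norm_eq_inner
        by (simp add: inner_add_left inner_add_right inner_commute ge[symmetric])
      have l: "((\<lambda>t. w (z + t *\<^sub>R e)) has_real_derivative g (z + t *\<^sub>R axis i 1) $ i) (at t)" for z t
        using has_derivative_line[OF grad, where x=z and t=t and v=e] by (simp add: ge) (simp add: e_def)
      show "(?\<phi> has_real_derivative ?p t) (at t)" for t
        unfolding nrm by (auto intro!: derivative_eq_intros l simp: algebra_simps)
      show "(?p has_real_derivative D p i - D q i - 2 * \<delta>\<^sup>2) (at 0)"
        by (auto intro!: derivative_eq_intros hess)
    qed
    have "(\<Sum>i\<in>UNIV. D p i - D q i - 2 * \<delta>\<^sup>2) \<le> 0"
      by (intro sum_nonpos Di)
    then have "(\<Sum>i\<in>UNIV. D p i) - (\<Sum>i\<in>UNIV. D q i) \<le> 2 * \<delta>\<^sup>2 * CARD('n)"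
      by (simp add: sum_subtractf mult_ac)
    then have "K p - K q \<le> 2 * \<delta>\<^sup>2 * CARD('n) - \<beta> p * (1 - (norm (g p))\<^sup>2)"
      unfolding lap gq by simp
    also have "\<dots> \<le> 2 * \<delta>\<^sup>2 * CARD('n) + \<bar>\<beta> p\<bar> * \<bar>1 - (norm (g p))\<^sup>2\<bar>"
      by (simp add: abs_mult[symmetric])
    also have "\<bar>\<beta> p\<bar> * \<bar>1 - (norm (g p))\<^sup>2\<bar> \<le> b * (4 * \<delta> * C + 4 * \<delta>\<^sup>2 * C\<^sup>2)"
      using b g1 b0 by (intro mult_mono) auto
    finally show ?thesis using \<kappa>(2)[OF wpq] by simp
  qed
  have "((\<lambda>\<delta>. \<delta>\<^sup>2 * (norm x)\<^sup>2) \<longlongrightarrow> 0\<^sup>2 * (norm x)\<^sup>2) (at_right (0::real))"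
    by (intro tendsto_intros)
  then have "\<forall>\<^sub>F \<delta> in at_right 0. \<delta>\<^sup>2 * (norm x)\<^sup>2 < M"
    by (rule order_tendstoD) (use M in simp)
  moreover have "\<forall>\<^sub>F \<delta> in at_right (0::real). \<delta> > 0" by (rule eventually_at_right_less)
  ultimately have "\<forall>\<^sub>F \<delta> in at_right (0::real).
      \<kappa> \<le> 2 * \<delta>\<^sup>2 * CARD('n) + b * (4 * \<delta> * C + 4 * \<delta>\<^sup>2 * C\<^sup>2)"
    by eventually_elim (use bound in auto)
  moreover have "((\<lambda>\<delta>. 2 * \<delta>\<^sup>2 * CARD('n) + b * (4 * \<delta> * C + 4 * \<delta>\<^sup>2 * C\<^sup>2)) \<longlongrightarrow>
      2 * (0::real)\<^sup>2 * CARD('n) + b * (4 * 0 * C + 4 * 0\<^sup>2 * C\<^sup>2)) (at_right (0::real))"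
    by (intro tendsto_intros)
  ultimately have "\<kappa> \<le> 2 * (0::real)\<^sup>2 * CARD('n) + b * (4 * 0 * C + 4 * 0\<^sup>2 * C\<^sup>2)"
    by (intro tendsto_lowerbound[of _ _ "at_right (0::real)"]) auto
  then show False using \<kappa> by simp
qed

section \<open>Gradients, and potentials up to the ends of the range\<close>

lemma C1_has_derivative:
  assumes "C1 f"
  shows "(f has_derivative (\<lambda>v. gradient f x \<bullet> v)) (at x)"
proof -
  have d: "(f has_derivative frechet_derivative f (at x)) (at x)"
    using assms frechet_derivative_works unfolding C1_def by blast
  then interpret bounded_linear "frechet_derivative f (at x)" by (rule has_derivative_bounded_linear)
  have "frechet_derivative f (at x) v = gradient f x \<bullet> v" for v
  proof -
    have "frechet_derivative f (at x) v = frechet_derivative f (at x) (\<Sum>i\<in>UNIV. (v $ i) *\<^sub>R axis i 1)"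
      using basis_expansion[of v] by (simp add: scalar_mult_eq_scaleR)
    also have "\<dots> = gradient f x \<bullet> v"
      by (simp add: sum scaleR gradient_def inner_vec_def partial_def mult.commute)
    finally show ?thesis .
  qed
  then have "frechet_derivative f (at x) = (\<lambda>v. gradient f x \<bullet> v)" by (rule ext)
  with d show ?thesis by simp
qed
text \<open>A bounded derivative on an interval makes \<open>F\<close> Lipschitz, hence uniformly
  continuous, hence extendable to the closure. The range of a component may fail to be closed; the
  extension supplies compactness.\<close>

lemma bounded_derivative_extend_closure:
  fixes F :: "real \<Rightarrow> real"
  assumes "connected S" "bounded S" "S \<noteq> {}"
    and d: "\<And>s. s \<in> S \<Longrightarrow> (F has_real_derivative f s) (at s within S)"
    and B: "\<And>s. s \<in> S \<Longrightarrow> \<bar>f s\<bar> \<le> B"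
  obtains a b E where "closure S = {a..b}" "continuous_on {a..b} E" "\<And>s. s \<in> S \<Longrightarrow> F s = E s"
proof -
  have "compact (closure S)" "connected (closure S)"
    using assms by (auto intro: connected_imp_connected_closure)
  then obtain a b where ab: "closure S = {a..b}"
    using connected_compact_interval_1 by blast
  have "convex S" using \<open>connected S\<close> by (simp add: is_interval_connected_1 is_interval_convex_1[symmetric])
  have "B \<ge> 0" using B \<open>S \<noteq> {}\<close> abs_ge_zero order_trans by blast
  have "B-lipschitz_on S F"
  proof (rule lipschitz_onI[OF _ \<open>B \<ge> 0\<close>])
    fix r s assume "r \<in> S" "s \<in> S"
    then show "dist (F r) (F s) \<le> B * dist r s"
      unfolding dist_norm using B by (intro field_differentiable_bound[OF \<open>convex S\<close> d]) auto
  qed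
  then have "uniformly_continuous_on S F" by (rule lipschitz_on_uniformly_continuous)
  then obtain E where E: "uniformly_continuous_on (closure S) E" "\<And>s. s \<in> S \<Longrightarrow> F s = E s"
    using uniformly_continuous_on_extension_on_closure by metis
  then show ?thesis using that ab uniformly_continuous_imp_continuous by metis
qed

lemma DERIV_inverse_sqrt:
  assumes "(G has_real_derivative G') (at s within S)" "G s > 0"
  shows "((\<lambda>s. 1 / sqrt (2 * G s)) has_real_derivative - G' * (1 / sqrt (2 * G s)) ^ 3) (at s within S)"
proof -
  have "((\<lambda>y. 1 / sqrt (2 * y)) has_real_derivative - ((1 / sqrt (2 * y)) ^ 3)) (at y)" if "y > 0" for y
    by (rule derivative_eq_intros refl | use that in \<open>simp add: field_simps power3_eq_cube power2_eq_square\<close>)+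
  from DERIV_chain'[OF assms(1) this[OF assms(2)]] show ?thesis by (simp add: mult.commute)
qed

section \<open>The gradient bound for a scalar equation\<close>

text \<open>The shift \<open>c\<close> keeps \<open>G\<close> away from 0, so
  \<open>1 / sqrt (2 * G)\<close> stays bounded even where \<open>F\<close> vanishes or tends to
  0.\<close>

lemma gradient_bound_shifted:
  fixes u :: "real^'n::finite \<Rightarrow> real"
  assumes C2: "C2 u" and bd: "bounded (range u)"
    and dF: "\<And>x. (F has_real_derivative laplacian u x) (at (u x) within range u)"
    and nonneg: "\<And>x. 0 \<le> F (u x)"
    and B: "\<And>x. \<bar>laplacian u x\<bar> \<le> B"
    and c: "c > 0"
  shows "(norm (gradient u x))\<^sup>2 \<le> 2 * (F (u x) + c)"
proof -
  define S where "S = range u"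
  define L where "L = laplacian u"
  have C1u: "C1 u" and C1p: "C1 (partial i u)" for i using C2 by (auto simp: C2_def)
  note du = C1_has_derivative[OF C1u] and dp = C1_has_derivative[OF C1p]
  have B0: "B \<ge> 0" using B[of 0] by linarith
  obtain U where U: "\<And>s. s \<in> S \<Longrightarrow> \<bar>s\<bar> \<le> U"
    using bd by (auto simp: bounded_iff S_def)
  have "continuous_on UNIV u"
    using du by (meson continuous_at_imp_continuous_on has_derivative_continuous)
  then have conn: "connected S" unfolding S_def by (rule connected_continuous_image[OF _ connected_UNIV])
  have "S \<noteq> {}" by (simp add: S_def)
  have inS [simp]: "u x \<in> S" for x by (simp add: S_def)
  \<comment> \<open>The derivative of \<open>F\<close> as a function of the value \<open>s\<close>,
    read off at a chosen preimage.\<close>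
  define f where "f s = L (inv u s)" for s
  have u_inv: "u (inv u s) = s" if "s \<in> S" for s using that by (simp add: S_def f_inv_into_f)
  have dFS: "(F has_real_derivative L x) (at (u x) within S)" for x
    using dF by (simp add: L_def S_def)
  have dFf: "(F has_real_derivative f s) (at s within S)" if "s \<in> S" for s
    using dFS[of "inv u s"] u_inv[OF that] by (simp add: f_def)
  have LB: "\<bar>L x\<bar> \<le> B" for x using B by (simp add: L_def)
  have fB: "\<bar>f s\<bar> \<le> B" for s using LB by (simp add: f_def)
  \<comment> \<open>On the closed interval the extension \<open>Fc\<close> has a maximum, and
    \<open>q\<close> built from it has an antiderivative.\<close>
  obtain a b Fc where ab: "closure S = {a..b}" and contFc: "continuous_on {a..b} Fc"
    and Fc: "\<And>s. s \<in> S \<Longrightarrow> F s = Fc s"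
    using bounded_derivative_extend_closure[OF conn _ \<open>S \<noteq> {}\<close> dFf fB] bd[folded S_def] by metis
  have Sab: "S \<subseteq> {a..b}" using ab closure_subset by metis
  have FcS: "Fc s \<ge> 0" if "s \<in> S" for s using nonneg[of "inv u s"] Fc[OF that] u_inv[OF that] by simp
  have Fc0: "Fc s \<ge> 0" if "s \<in> {a..b}" for s
    by (rule continuous_ge_on_closure[of S Fc]) (use contFc that FcS in \<open>auto simp: ab\<close>)
  have Uc: "\<bar>s\<bar> \<le> U" if "s \<in> {a..b}" for s
    by (rule continuous_le_on_closure[of S]) (use that U in \<open>auto simp: ab intro!: continuous_intros\<close>)
  obtain A where "\<forall>y\<in>Fc ` {a..b}. norm y \<le> A"
    using compact_imp_bounded[OF compact_continuous_image[OF contFc compact_Icc]]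
    unfolding bounded_iff by blast
  then have A: "\<bar>Fc s\<bar> \<le> A" if "s \<in> {a..b}" for s using that by auto
  have A0: "A \<ge> 0" using A[of "u 0"] Sab inS[of 0] by (meson abs_ge_zero order_trans subsetD)

  \<comment> \<open>With this \<open>\<mu>\<close>, \<open>(ln K)' = \<mu> - G'/(2G) \<ge> 1\<close>; with this \<open>\<delta>\<close>, \<open>G \<ge> c/2\<close>.\<close>
  define \<mu> where "\<mu> = B / c + 1"
  define \<delta> where "\<delta> = c / 2 * exp (- (\<mu> * U))"
  define E where "E s = \<delta> * exp (\<mu> * s)" for s
  define G where "G s = Fc s + c - E s" for s
  define q where "q s = 1 / sqrt (2 * G s)" for s
  have \<mu>: "\<mu> > 0" using B0 c by (simp add: \<mu>_def add_nonneg_pos)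
  have \<delta>: "\<delta> > 0" using c by (simp add: \<delta>_def)
  have E0: "E s > 0" for s using \<delta> by (simp add: E_def)
  have Ec: "E s \<le> c / 2" if "s \<in> {a..b}" for s
  proof -
    have "\<mu> * s \<le> \<mu> * U" using Uc[OF that] \<mu> by (intro mult_left_mono) auto
    then have "E s \<le> \<delta> * exp (\<mu> * U)" using \<delta> by (simp add: E_def)
    also have "\<dots> = c / 2" by (simp add: \<delta>_def exp_minus)
    finally show ?thesis .
  qed
  have Gc: "G s \<ge> c / 2" if "s \<in> {a..b}" for s using Fc0[OF that] Ec[OF that] by (simp add: G_def)
  then have G0: "G s > 0" if "s \<in> {a..b}" for s using c that by (meson half_gt_zero less_le_trans)
  have q0: "q s > 0" if "s \<in> {a..b}" for s using G0[OF that] by (simp add: q_def)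
  have qS: "q s \<ge> 0" if "s \<in> S" for s using less_imp_le[OF q0, of s] that Sab by blast
  have q2: "(q s)\<^sup>2 = 1 / (2 * G s)" if "s \<in> {a..b}" for s
    using G0[OF that] by (simp add: q_def power_divide)
  have qc2: "(q s)\<^sup>2 \<le> 1 / c" if "s \<in> {a..b}" for s
    using Gc[OF that] c unfolding q2[OF that] by (intro divide_left_mono) auto
  have qc: "q s \<le> 1 / sqrt c" if "s \<in> {a..b}" for s
    using Gc[OF that] c unfolding q_def by (intro divide_left_mono real_sqrt_le_mono mult_pos_pos) auto
  have contq: "continuous_on {a..b} q"
    unfolding q_def G_def E_def using G0
    by (intro continuous_intros contFc) (force simp: G_def E_def)
  obtain \<psi> where \<psi>: "\<And>s. s \<in> {a..b} \<Longrightarrow> (\<psi> has_vector_derivative q s) (at s within {a..b})"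
    using antiderivative_continuous[OF contq] by metis
  have d\<psi>: "(\<psi> has_real_derivative q s) (at s within S)" if "s \<in> S" for s
    using has_vector_derivative_within_subset[OF \<psi> Sab] that Sab
    by (auto simp: has_real_derivative_iff_has_vector_derivative)
  \<comment> \<open>The derivative \<open>l\<close> of \<open>F\<close> is left free: the equation
    for \<open>w\<close> takes it as \<open>L x\<close>, the monotonicity of \<open>K\<close> as
    \<open>f s\<close>.\<close>
  have dG: "(G has_real_derivative l - \<mu> * E s) (at s within S)"
    if "s \<in> S" "(F has_real_derivative l) (at s within S)" for s l
  proof -
    have "(Fc has_real_derivative l) (at s within S)"
      using has_derivative_transform[of s S Fc F] Fc that by (simp add: has_field_derivative_def)
    then show ?thesis unfolding G_def E_def
      by (auto intro!: derivative_eq_intros)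
  qed
  have dq: "(q has_real_derivative - (l - \<mu> * E s) * (q s) ^ 3) (at s within S)"
    if "s \<in> S" "(F has_real_derivative l) (at s within S)" for s l
    using DERIV_inverse_sqrt[OF dG[OF that] G0] that Sab unfolding q_def by auto

  define w where "w x = \<psi> (u x)" for x
  define g where "g x = q (u x) *\<^sub>R gradient u x" for x
  \<comment> \<open>With \<open>G' = L x - \<mu> * E (u x)\<close> and
    \<open>q' = - G' * q^3\<close>, the Laplacian of \<open>w\<close> is
    \<open>q * L x - G' * q * (norm (g x))^2\<close>. Adding and subtracting \<open>G' * q\<close>
    gives \<open>\<beta> = G' * q\<close> and
    \<open>K = q * (L x - G') = q * \<mu> * E\<close>.\<close>
  define \<beta> where "\<beta> x = (L x - \<mu> * E (u x)) * q (u x)" for x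
  define K where "K s = q s * (\<mu> * E s)" for s
  have "continuous_on {a..b} \<psi>"
    using \<psi> continuous_on_vector_derivative by blast
  from compact_imp_bounded[OF compact_continuous_image[OF this compact_Icc]]
  obtain W where "\<forall>y\<in>\<psi> ` {a..b}. norm y \<le> W" unfolding bounded_iff by blast
  then have W: "\<bar>\<psi> s\<bar> \<le> W" if "s \<in> {a..b}" for s using that by auto
  have uab: "u x \<in> {a..b}" for x using Sab inS by blast

  have dw: "(w has_derivative (\<lambda>v. g x \<bullet> v)) (at x)" for x
  proof -
    have "(\<psi> has_derivative (*) (q (u x))) (at (u x) within range u)"
      using d\<psi>[of "u x"] by (simp add: has_field_derivative_def S_def)
    from diff_chain_within[OF du this] show ?thesis
      by (simp add: o_def w_def[abs_def] g_def)
  qed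

  have lip: "w x - w y \<le> norm (x - y)" for x y
  proof (rule two_point_Lipschitz[where g = g and \<beta> = \<beta> and K = "\<lambda>x. K (u x)"
        and b = "(B + \<mu> * (c / 2)) * (1 / sqrt c)"
        and D = "\<lambda>x i. - (L x - \<mu> * E (u x)) * (q (u x)) ^ 3 * (partial i u x)\<^sup>2
            + q (u x) * partial i (partial i u) x"])
    show "\<bar>w x\<bar> \<le> W" for x using W[OF uab] by (simp add: w_def)
    show "(w has_derivative (\<lambda>v. g x \<bullet> v)) (at x)" for x by (rule dw)
    show "((\<lambda>t. g (x + t *\<^sub>R axis i 1) $ i) has_real_derivative
        - (L x - \<mu> * E (u x)) * (q (u x)) ^ 3 * (partial i u x)\<^sup>2
            + q (u x) * partial i (partial i u) x) (at 0)" for x i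
    proof -
      let ?h = "\<lambda>t. u (x + t *\<^sub>R axis i 1)"
      have h: "(?h has_real_derivative partial i u x) (at 0)"
        using has_derivative_line[OF du, where x=x and t=0 and v="axis i 1"] by (simp add: inner_axis gradient_def)
      have p: "((\<lambda>t. partial i u (x + t *\<^sub>R axis i 1)) has_real_derivative partial i (partial i u) x) (at 0)"
        using has_derivative_line[OF dp, where x=x and t=0 and v="axis i 1"] by (simp add: inner_axis gradient_def)
      \<comment> \<open>As \<open>q\<close> is differentiable only within \<open>S\<close>, the
        chain rule used is the one for derivatives within the image of the inner function.\<close>
      have "(q has_real_derivative - (L x - \<mu> * E (u x)) * (q (u x)) ^ 3) (at (?h 0) within range ?h)"
        using has_field_derivative_subset[OF dq[OF inS dFS], of "range ?h" x] by (auto simp: S_def)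
      from DERIV_image_chain[OF this h]
      have "((\<lambda>t. q (?h t)) has_real_derivative
          - (L x - \<mu> * E (u x)) * (q (u x)) ^ 3 * partial i u x) (at 0)"
        by (simp add: o_def)
      from DERIV_mult[OF this p] show ?thesis
        by (simp add: g_def gradient_def power2_eq_square algebra_simps)
    qed
    show "(\<Sum>i\<in>UNIV. - (L x - \<mu> * E (u x)) * (q (u x)) ^ 3 * (partial i u x)\<^sup>2
            + q (u x) * partial i (partial i u) x)
        = K (u x) + \<beta> x * (1 - (norm (g x))\<^sup>2)" for x
    proof -
      have n: "(norm (g x))\<^sup>2 = (q (u x))\<^sup>2 * (\<Sum>i\<in>UNIV. (partial i u x)\<^sup>2)"
        unfolding g_def norm_scaleR power_mult_distrib power2_norm_eq_inner
        by (simp add: inner_vec_def gradient_def power2_eq_square)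
      have l: "L x = (\<Sum>i\<in>UNIV. partial i (partial i u) x)" by (simp add: L_def laplacian_def)
      have "(\<Sum>i\<in>UNIV. - (L x - \<mu> * E (u x)) * (q (u x)) ^ 3 * (partial i u x)\<^sup>2
            + q (u x) * partial i (partial i u) x)
        = - (L x - \<mu> * E (u x)) * (q (u x)) ^ 3 * (\<Sum>i\<in>UNIV. (partial i u x)\<^sup>2) + q (u x) * L x"
        unfolding sum.distrib sum_distrib_left[symmetric] l[symmetric] ..
      then show ?thesis unfolding n K_def \<beta>_def
        by (simp add: power2_eq_square power3_eq_cube algebra_simps)
    qed
    show "\<bar>\<beta> x\<bar> \<le> (B + \<mu> * (c / 2)) * (1 / sqrt c)" for x
    proof -
      have "\<bar>\<mu> * E (u x)\<bar> \<le> \<mu> * (c / 2)"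
        using \<mu> E0[of "u x"] Ec[OF uab, of x] by (simp add: abs_mult)
      then have "\<bar>L x - \<mu> * E (u x)\<bar> \<le> B + \<mu> * (c / 2)" using LB[of x] by linarith
      moreover have "\<bar>q (u x)\<bar> \<le> 1 / sqrt c" using q0[OF uab, of x] qc[OF uab, of x] by simp
      ultimately show ?thesis unfolding \<beta>_def abs_mult
        using B0 \<mu> c by (intro mult_mono) auto
    qed
    show "\<exists>\<kappa>>0. \<forall>x y. w x - w y \<ge> M \<longrightarrow> K (u x) - K (u y) \<ge> \<kappa>" if "M > 0" for M
    proof -
      \<comment> \<open>A lower bound for \<open>K\<close>, from \<open>G s \<le> A + c\<close> and
        \<open>s \<ge> - U\<close>. It bounds \<open>K'\<close> as well, because
        \<open>K' = K * (\<mu> - G' * q^2)\<close> and the second factor is at least 1.\<close>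
      define m where "m = 1 / sqrt (2 * (A + c)) * (\<mu> * (\<delta> * exp (- (\<mu> * U))))"
      have m0: "m > 0" using A0 c \<mu> \<delta> by (simp add: m_def)
      have mK: "m \<le> K s" if "s \<in> {a..b}" for s
      proof -
        have "G s \<le> A + c" using A[OF that] E0[of s] by (simp add: G_def)
        then have "1 / sqrt (2 * (A + c)) \<le> q s"
          unfolding q_def using G0[OF that] A0 c
          by (intro divide_left_mono real_sqrt_le_mono mult_pos_pos) auto
        moreover have "- (\<mu> * U) \<le> \<mu> * s"
          using mult_left_mono[of "- U" s \<mu>] Uc[OF that] \<mu> by auto
        then have "\<mu> * (\<delta> * exp (- (\<mu> * U))) \<le> \<mu> * E s"
          using \<mu> \<delta> by (simp add: E_def)
        ultimately show ?thesis unfolding m_def K_def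
          using \<mu> \<delta> q0[OF that] by (intro mult_mono) auto
      qed
      define K' where "K' s = - (f s - \<mu> * E s) * (q s) ^ 3 * (\<mu> * E s) + q s * (\<mu> * (\<mu> * E s))" for s
      have dK: "(K has_real_derivative K' s) (at s within S)" if "s \<in> S" for s
      proof -
        have "((\<lambda>s. \<mu> * E s) has_real_derivative \<mu> * (\<mu> * E s)) (at s within S)"
          unfolding E_def by (auto intro!: derivative_eq_intros)
        from DERIV_mult[OF dq[OF that dFf[OF that]] this] show ?thesis
          unfolding K_def K'_def by (simp add: algebra_simps)
      qed
      have K'm: "m \<le> K' s" if "s \<in> S" for s
      proof -
        have s: "s \<in> {a..b}" using that Sab by blast
        have "(f s - \<mu> * E s) * (q s)\<^sup>2 \<le> B * (1 / c)"
        proof -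
          have "(f s - \<mu> * E s) * (q s)\<^sup>2 \<le> B * (q s)\<^sup>2"
            using fB[of s] mult_pos_pos[OF \<mu> E0[of s]] by (intro mult_right_mono) auto
          also have "\<dots> \<le> B * (1 / c)" using B0 qc2[OF s] by (intro mult_left_mono)
          finally show ?thesis .
        qed
        then have "1 \<le> \<mu> - (f s - \<mu> * E s) * (q s)\<^sup>2" by (simp add: \<mu>_def)
        moreover have "K s \<ge> 0" using q0[OF s] \<mu> E0[of s] by (simp add: K_def)
        ultimately have "K s * 1 \<le> K s * (\<mu> - (f s - \<mu> * E s) * (q s)\<^sup>2)"
          by (rule mult_left_mono)
        also have "\<dots> = K' s"
          by (simp add: K_def K'_def power2_eq_square power3_eq_cube algebra_simps)
        finally show ?thesis using mK[OF s] by simp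
      qed
      have seg: "{r..s} \<subseteq> S" if "r \<in> S" "s \<in> S" for r s
        using connected_contains_Icc[OF conn that] .
      \<comment> \<open>Since \<open>q \<le> 1 / sqrt c\<close>, a gap \<open>M\<close> in
        \<open>w\<close> forces a gap \<open>M * sqrt c\<close> in \<open>u\<close>, which
        \<open>K' \<ge> m\<close> turns into a gap in \<open>K\<close>.\<close>
      have "K (u x) - K (u y) \<ge> m * (M * sqrt c)" if xy: "w x - w y \<ge> M" for x y
      proof -
        have le: "u y \<le> u x"
        proof (rule ccontr)
          assume "\<not> u y \<le> u x"
          then have "0 * (u y - u x) \<le> \<psi> (u y) - \<psi> (u x)"
            using qS by (intro increment_ge_of_derivative_ge[OF _ seg d\<psi>]) auto
          then show False using xy \<open>M > 0\<close> by (simp add: w_def)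
        qed
        \<comment> \<open>Passing to \<open>- \<psi>\<close> turns the lower increment bound into
          the upper one needed here.\<close>
        have "- (1 / sqrt c) * (u x - u y) \<le> (- \<psi> (u x)) - (- \<psi> (u y))"
        proof (rule increment_ge_of_derivative_ge[OF le seg])
          show "((\<lambda>s. - \<psi> s) has_real_derivative - q s) (at s within S)" if "s \<in> S" for s
            using d\<psi>[OF that] by (rule DERIV_minus)
          show "- (1 / sqrt c) \<le> - q s" if "s \<in> S" for s using qc that Sab by auto
        qed auto
        then have "M \<le> (u x - u y) / sqrt c" using xy by (simp add: w_def)
        then have "M * sqrt c \<le> u x - u y" using c by (simp add: field_simps)
        then have "m * (M * sqrt c) \<le> m * (u x - u y)" using m0 by simp
        also have "\<dots> \<le> K (u x) - K (u y)"
          by (rule increment_ge_of_derivative_ge[OF le seg dK K'm]) auto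
        finally show ?thesis .
      qed
      moreover have "m * (M * sqrt c) > 0" using m0 \<open>M > 0\<close> c by simp
      ultimately show ?thesis by blast
    qed
  qed
  have "norm (g x) \<le> 1" using dw lip by (rule gradient_norm_le_one)
  then have "(norm (g x))\<^sup>2 \<le> 1" by (simp add: power_le_one)
  then have "(norm (gradient u x))\<^sup>2 / (2 * G (u x)) \<le> 1"
    using q2[OF uab, of x] by (simp add: g_def power_mult_distrib)
  then have "(norm (gradient u x))\<^sup>2 \<le> 2 * G (u x)" using G0[OF uab, of x] by simp
  also have "\<dots> \<le> 2 * (F (u x) + c)" using E0[of "u x"] Fc[OF inS, of x] by (simp add: G_def)
  finally show ?thesis .
qed

text \<open>Apply the shifted bound to \<open>V\<close> minus its infimum, which is nonnegative on
  the range, and let \<open>c\<close> tend to 0.\<close>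

lemma scalar_Modica:
  fixes u :: "real^'n::finite \<Rightarrow> real"
  assumes C2: "C2 u" and bd: "bounded (range u)"
    and dV: "\<And>x. (V has_real_derivative laplacian u x) (at (u x) within range u)"
    and B: "\<And>x. \<bar>laplacian u x\<bar> \<le> B"
  shows "1/2 * (norm (gradient u x))\<^sup>2 \<le> V (u x) - (INF p\<in>range u. V p)"
proof -
  have C1u: "C1 u" using C2 by (simp add: C2_def)
  have "continuous_on UNIV u"
    using C1_has_derivative[OF C1u] by (meson continuous_at_imp_continuous_on has_derivative_continuous)
  then have conn: "connected (range u)" by (rule connected_continuous_image[OF _ connected_UNIV])
  have d: "(V has_real_derivative laplacian u (inv u s)) (at s within range u)" if "s \<in> range u" for s
    using dV[of "inv u s"] that by (simp add: f_inv_into_f)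
  obtain a b E where E: "closure (range u) = {a..b}" "continuous_on {a..b} E"
    "\<And>s. s \<in> range u \<Longrightarrow> V s = E s"
    using bounded_derivative_extend_closure[OF conn bd _ d B] by (metis UNIV_not_empty image_is_empty)
  \<comment> \<open>Boundedness below makes \<open>INF\<close> a genuine lower bound of
    \<open>V\<close> on the range; the continuous extension to a compact interval provides
    it.\<close>
  have "V ` range u \<subseteq> E ` {a..b}" using E closure_subset[of "range u"] by auto
  moreover have "bounded (E ` {a..b})"
    using compact_imp_bounded[OF compact_continuous_image[OF E(2) compact_Icc]] .
  ultimately have bb: "bdd_below (V ` range u)"
    by (intro bounded_imp_bdd_below) (rule bounded_subset)
  define I where "I = (INF p\<in>range u. V p)"
  have I: "I \<le> V (u x)" for x unfolding I_def by (rule cINF_lower[OF bb]) simp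
  have "(norm (gradient u x))\<^sup>2 \<le> 2 * ((V (u x) - I) + c)" if "c > 0" for c
  proof (rule gradient_bound_shifted[OF C2 bd _ _ B that])
    show "((\<lambda>s. V s - I) has_real_derivative laplacian u x) (at (u x) within range u)" for x
      using dV[of x] by (auto intro!: derivative_eq_intros)
  qed (use I in auto)
  then have "1/2 * (norm (gradient u x))\<^sup>2 \<le> (V (u x) - I) + c" if "c > 0" for c
    using that by fastforce
  then show ?thesis unfolding I_def[symmetric] by (rule field_le_epsilon)
qed

section \<open>Summation over the components\<close>

theorem corollary3p4:
  fixes H :: "real^'m::finite \<Rightarrow> real"
    and u :: "real^'n::finite \<Rightarrow> real^'m"
    and k :: 'n
    and V :: "'m \<Rightarrow> real \<Rightarrow> real"
  assumes "CARD('m) \<ge> 2"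
    and "C2 H"
    and "classical_solution H u"
    and "bounded (range u)"
    and "monotone_in k u"
    and "common_level_sets u"
    and "decoupling_potentials H u V"
  shows "\<forall>x. (1/2) * (\<Sum>i\<in>UNIV. (norm (gradient (component u i) x))\<^sup>2)
             \<le> H (u x) - (\<Sum>i\<in>UNIV. (INF p\<in>range (component u i). V i p))"
proof
  fix x
  have "1/2 * (norm (gradient (component u i) x))\<^sup>2
      \<le> V i (component u i x) - (INF p\<in>range (component u i). V i p)" for i
  proof -
    \<comment> \<open>The Laplacian of each component is a partial derivative of \<open>H\<close>
      along \<open>u\<close>, hence bounded by continuity on the compact closure of the
      range.\<close>
    have "compact (closure (range u))" using assms(4) by simp
    moreover have "continuous_on (closure (range u)) (partial i H)"
      using \<open>C2 H\<close> continuous_on_subset unfolding C2_def C1_def by blast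
    ultimately have "bounded (partial i H ` closure (range u))"
      by (intro compact_imp_bounded compact_continuous_image)
    then obtain B where B: "\<And>p. p \<in> closure (range u) \<Longrightarrow> \<bar>partial i H p\<bar> \<le> B"
      by (auto simp: bounded_iff)
    have "\<bar>laplacian (component u i) y\<bar> \<le> B" for y
      using assms(3) B[of "u y"] closure_subset[of "range u"] by (auto simp: classical_solution_def)
    moreover have "range (component u i) = (\<lambda>p. p $ i) ` range u"
      by (auto simp: component_def)
    then have "bounded (range (component u i))"
      using bounded_linear_image[OF assms(4) bounded_linear_vec_nth] by simp
    ultimately show ?thesis
      using assms(3,7) by (intro scalar_Modica) (auto simp: classical_solution_def decoupling_potentials_def)
  qed
  then have "(\<Sum>i\<in>UNIV. 1/2 * (norm (gradient (component u i) x))\<^sup>2)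
      \<le> (\<Sum>i\<in>UNIV. V i (component u i x) - (INF p\<in>range (component u i). V i p))"
    by (rule sum_mono)
  \<comment> \<open>The potentials evaluated along \<open>u\<close> sum to
    \<open>H (u x)\<close>.\<close>
  then show "(1/2) * (\<Sum>i\<in>UNIV. (norm (gradient (component u i) x))\<^sup>2)
             \<le> H (u x) - (\<Sum>i\<in>UNIV. (INF p\<in>range (component u i). V i p))"
    using assms(7) unfolding decoupling_potentials_def sum_subtractf sum_distrib_left by simp
qed
end
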